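(* Let $n\ge1$ and $\rho \in (-1,1)$. Let $f,g:\mathbb{F}_2^n\to\{\pm1\}$ be unbiased Boolean functions, i.e., $\widehat{f}(\emptyset)=\widehat{g}(\emptyset)=0$. Then $$G(n,f,g,\rho) \le \max_{1\le k \le n} \frac{k^2 \rho^{2(k-1)}}{1-\rho^{2k}}.$$
   Context: $\mathbb{F}_2=\{0,1\}$. For $\rho\in[-1,1]$, a pair $(X^n,Y^n)$ of random vectors in $\mathbb{F}_2^n$ is called $\rho$-correlated if $X^n$ is uniform on $\mathbb{F}_2^n$ and, independently for each $i\in\{1,\dots,n\}$, $Y_i=X_i$ with probability $\frac{1+\rho}{2}$ and $Y_i=X_i+1$ with probability $\frac{1-\rho}{2}$. For functions $f,g:\mathbb{F}_2^n\to\{\pm1\}$, $P_{f(X^n)g(Y^n),\rho}$ denotes the joint distribution on $\{\pm1\}^2$ of $(f(X^n),g(Y^n))$ when $(X^n,Y^n)$ is $\rho$-correlated. $\widehat{f}(\emptyset)=\mathbb{E}[f(X^n)]=2^{-n}\sum_{\bm{x}\in\mathbb{F}_2^n} f(\bm{x})$. For $\rho\in(-1,1)$, the Fisher information of the family $\{P_{f(X^n)g(Y^n),\rho}\}_{\rho\in(-1,1)}$ is $$G(n,f,g,\rho) := \mathbb{E}\bigg[ \bigg( \frac{d}{d\rho} \ln P_{f(X^n)g(Y^n),\rho}(f(X^n),g(Y^n)) \bigg)^2 \bigg],$$ the expectation being over a $\rho$-correlated pair, i.e. $G(n,f,g,\rho)=\sum_{u,v}\big(\frac{d}{d\rho}P_{f(X^n)g(Y^n),\rho}(u,v)\big)^2/P_{f(X^n)g(Y^n),\rho}(u,v)$,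 summed over $(u,v)\in\{\pm1\}^2$ of positive probability. Convention: $0^0=1$. *)

theory Defs
  imports "HOL-Probability.Probability" "HOL-Library.Z2"
begin

text \<open>
  The space of binary vectors of length n is \<open>bit ^ 'n\<close> with \<open>n = CARD('n)\<close>; the index type is
  nonempty, so \<open>n \<ge> 1\<close>. Boolean functions are real-valued with range in \<open>{-1, 1}\<close>.
\<close>

instance bit :: finite
proof
  have "(UNIV :: bit set) = {0, 1}"
    using bit.exhaust by auto
  then show "finite (UNIV :: bit set)"
    by (metis finite.emptyI finite_insert)
qed

text \<open>
  Joint law of a correlated pair: \<open>X\<close> is uniform and \<open>Y = X + Z\<close>, where the coordinates of \<open>Z\<close>
  are independent of each other and of \<open>X\<close>, each being 1 with probability \<open>(1 - \<rho>) / 2\<close>.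
  Meaningful for \<open>\<rho> \<in> {-1..1}\<close> only: \<open>bernoulli_pmf\<close> clamps its parameter.
\<close>

definition correlated_pmf :: "real \<Rightarrow> ((bit ^ 'n) \<times> (bit ^ 'n)) pmf" where
  "correlated_pmf \<rho> =
     bind_pmf (pmf_of_set UNIV) (\<lambda>x.
       map_pmf (\<lambda>z. (x, x + (\<chi> i. z i)))
         (Pi_pmf UNIV 0 (\<lambda>_. map_pmf of_bool (bernoulli_pmf ((1 - \<rho>) / 2)))))"

definition joint_pmf ::
    "(bit ^ 'n \<Rightarrow> real) \<Rightarrow> (bit ^ 'n \<Rightarrow> real) \<Rightarrow> real \<Rightarrow> (real \<times> real) pmf" where
  "joint_pmf f g \<rho> = map_pmf (\<lambda>(x, y). (f x, g y)) (correlated_pmf \<rho>)"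

text \<open>
  The expectation only involves values \<open>(f x, g y)\<close> of positive probability, where the logarithm
  is differentiable for \<open>\<rho> \<in> {-1<..<1}\<close>.
\<close>

definition fisher_information ::
    "(bit ^ 'n \<Rightarrow> real) \<Rightarrow> (bit ^ 'n \<Rightarrow> real) \<Rightarrow> real \<Rightarrow> real" where
  "fisher_information f g \<rho> =
     measure_pmf.expectation (correlated_pmf \<rho>)
       (\<lambda>(x, y). (deriv (\<lambda>r. ln (pmf (joint_pmf f g r) (f x, g y))) \<rho>)\<^sup>2)"

definition fourier_empty :: "(bit ^ 'n \<Rightarrow> real) \<Rightarrow> real" where
  "fourier_empty f = measure_pmf.expectation (pmf_of_set UNIV) f"

end

theory Submission
  imports Defs
begin

text \<open>
  The noise operator is diagonal in the Walsh basis, so the correlation of \<open>f(X)\<close> and \<open>g(Y)\<close> is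
  the polynomial \<open>s(\<rho>) = \<Sum>S. a S * \<rho> ^ card S\<close> with \<open>a S\<close> the product of the Fourier coefficients
  of \<open>f\<close> and \<open>g\<close> at \<open>S\<close>. For unbiased functions the joint law depends on \<open>\<rho>\<close> only through \<open>s\<close>, and
  its Fisher information is \<open>s'\<^sup>2 / (1 - s\<^sup>2)\<close>. By Parseval \<open>(\<Sum>S. \<bar>a S\<bar>) \<le> 1\<close>, and the bound
  \<open>s'\<^sup>2 \<le> M * (1 - s\<^sup>2)\<close>, which holds by the choice of \<open>M\<close> for each monomial \<open>\<rho> ^ k\<close> with \<open>k \<ge> 1\<close>,
  passes to \<open>s\<close> by the Cauchy-Schwarz inequality with the weights \<open>\<bar>a S\<bar>\<close>.
\<close>

section \<open>Fourier analysis on the discrete cube\<close>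

lemma UNIV_bit: "(UNIV :: bit set) = {0, 1}"
  using bit.exhaust by auto

definition bit_sign :: "bit \<Rightarrow> real" where
  "bit_sign b = (if b = 0 then 1 else -1)"

lemma bit_sign_simps [simp]: "bit_sign 0 = 1" "bit_sign 1 = -1"
  by (simp_all add: bit_sign_def)

lemma bit_sign_add: "bit_sign (a + b) = bit_sign a * bit_sign b"
  by (cases a; cases b) simp_all

definition walsh :: "'n set \<Rightarrow> bit ^ 'n \<Rightarrow> real" where
  "walsh S x = (\<Prod>i\<in>S. bit_sign (x $ i))"

definition fourier_coeff :: "(bit ^ 'n \<Rightarrow> real) \<Rightarrow> 'n::finite set \<Rightarrow> real" where
  "fourier_coeff f S = (\<Sum>x\<in>UNIV. f x * walsh S x) / CARD(bit ^ 'n)"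

lemma sum_mult_walsh:
  fixes f :: "bit ^ 'n \<Rightarrow> real"
  shows "(\<Sum>x\<in>UNIV. f x * walsh S x) = fourier_coeff f S * CARD(bit ^ 'n)"
  by (simp add: fourier_coeff_def)

lemma walsh_add: "walsh S (x + y) = walsh S x * walsh S y"
  unfolding walsh_def vector_add_component bit_sign_add by (rule prod.distrib)

lemma walsh_empty [simp]: "walsh {} x = 1"
  by (simp add: walsh_def)

text \<open>The sum over subsets is the expanded product of the factors
  \<open>bit_sign (x $ i) + 1\<close>, and a single coordinate equal to 1 makes it vanish.\<close>

lemma sum_walsh:
  fixes x :: "bit ^ 'n"
  shows "(\<Sum>S\<in>UNIV. walsh S x) = (if x = 0 then real CARD(bit ^ 'n) else 0)"
proof -
  have "(\<Sum>S\<in>UNIV. walsh S x) = (\<Prod>i\<in>UNIV. bit_sign (x $ i) + 1)"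
    by (simp add: walsh_def prod_add)
  also have "\<dots> = (if x = 0 then 2 ^ CARD('n) else 0)"
  proof (cases "x = 0")
    case False
    then obtain i where "x $ i = 1"
      by (auto simp: vec_eq_iff)
    then have "bit_sign (x $ i) + 1 = 0"
      by simp
    then show ?thesis
      using False by (metis UNIV_I finite_code prod_zero)
  qed simp
  finally show ?thesis
    by (simp add: UNIV_bit)
qed

text \<open>Once the coefficients are inserted, \<open>walsh_add\<close> merges the two characters
  into \<open>walsh S (x + y)\<close>. Summing over \<open>S\<close> leaves only x + y = 0, which in
  characteristic 2 means x = y.\<close>

lemma fourier_expansion:
  fixes f :: "bit ^ 'n \<Rightarrow> real"
  shows "f y = (\<Sum>S\<in>UNIV. fourier_coeff f S * walsh S y)"
proof -
  have add_eq_0: "x + y = 0 \<longleftrightarrow> x = y" for x :: "bit ^ 'n"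
  proof -
    have "a + b = 0 \<longleftrightarrow> a = b" for a b :: bit
      by (cases a; cases b) simp_all
    then show ?thesis
      by (simp add: vec_eq_iff)
  qed
  have "(\<Sum>S\<in>UNIV. fourier_coeff f S * walsh S y)
      = (\<Sum>S\<in>UNIV. \<Sum>x\<in>UNIV. f x * walsh S (x + y)) / CARD(bit ^ 'n)"
    unfolding fourier_coeff_def walsh_add sum_divide_distrib sum_distrib_right
    by (simp add: mult_ac)
  also have "\<dots> = (\<Sum>x\<in>UNIV. f x * (\<Sum>S\<in>UNIV. walsh S (x + y))) / CARD(bit ^ 'n)"
    by (subst sum.swap) (simp add: sum_distrib_left)
  also have "\<dots> = (\<Sum>x\<in>UNIV. if x = y then f x * CARD(bit ^ 'n) else 0) / CARD(bit ^ 'n)"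
    unfolding sum_walsh add_eq_0 by (intro arg_cong2[where f = "(/)"] sum.cong) auto
  also have "\<dots> = f y"
    by simp
  finally show ?thesis ..
qed

text \<open>Expanding just one of the two factors \<open>f x\<close> lets the sum over
  \<open>x\<close> become a coefficient again.\<close>

lemma parseval:
  fixes f :: "bit ^ 'n \<Rightarrow> real"
  shows "(\<Sum>S\<in>UNIV. (fourier_coeff f S)\<^sup>2) = (\<Sum>x\<in>UNIV. (f x)\<^sup>2) / CARD(bit ^ 'n)"
proof -
  have "(\<Sum>x\<in>UNIV. (f x)\<^sup>2) = (\<Sum>x\<in>UNIV. f x * (\<Sum>S\<in>UNIV. fourier_coeff f S * walsh S x))"
    by (simp add: power2_eq_square flip: fourier_expansion)
  also have "\<dots> = (\<Sum>S\<in>UNIV. \<Sum>x\<in>UNIV. f x * (fourier_coeff f S * walsh S x))"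
    unfolding sum_distrib_left by (rule sum.swap)
  also have "\<dots> = (\<Sum>S\<in>UNIV. fourier_coeff f S * (\<Sum>x\<in>UNIV. f x * walsh S x))"
    by (simp add: sum_distrib_left mult_ac)
  also have "\<dots> / CARD(bit ^ 'n) = (\<Sum>S\<in>UNIV. (fourier_coeff f S)\<^sup>2)"
    by (simp add: sum_mult_walsh power2_eq_square flip: sum_distrib_right mult.assoc)
  finally show ?thesis ..
qed

lemma fourier_empty_eq: "fourier_empty f = fourier_coeff f {}"
  by (simp add: fourier_empty_def fourier_coeff_def integral_pmf_of_set)

text \<open>By Parseval the squared coefficients add up to 1, and the one at \<open>{}\<close>
  already accounts for all of it.\<close>

lemma fourier_coeff_const:
  "fourier_coeff (\<lambda>x :: bit ^ 'n. 1) S = (if S = {} then 1 else 0)"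
proof (cases "S = {}")
  case False
  have sq: "(\<Sum>S\<in>UNIV. (fourier_coeff (\<lambda>x :: bit ^ 'n. 1) S)\<^sup>2) = 1"
    by (simp add: parseval)
  have "(\<Sum>T\<in>{{}, S}. (fourier_coeff (\<lambda>x :: bit ^ 'n. 1) T)\<^sup>2) \<le>
      (\<Sum>S\<in>UNIV. (fourier_coeff (\<lambda>x :: bit ^ 'n. 1) S)\<^sup>2)"
    by (rule sum_mono2) auto
  with False sq show ?thesis
    by (simp add: fourier_coeff_def)
qed (simp add: fourier_coeff_def)

text \<open>Cauchy-Schwarz for two coefficient vectors, both of norm 1 by Parseval.\<close>

lemma sum_abs_fourier_coeff_le:
  fixes f g :: "bit ^ 'n \<Rightarrow> real"
  assumes "range f \<subseteq> {-1, 1}" and "range g \<subseteq> {-1, 1}"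
  shows "(\<Sum>S\<in>UNIV. \<bar>fourier_coeff f S * fourier_coeff g S\<bar>) \<le> 1"
proof -
  have parseval_eq_1: "(\<Sum>S\<in>UNIV. (fourier_coeff h S)\<^sup>2) = 1"
    if "range h \<subseteq> {-1, 1}" for h :: "bit ^ 'n \<Rightarrow> real"
  proof -
    have "(h x)\<^sup>2 = 1" for x
      using that by (auto simp: power2_eq_1_iff image_subset_iff)
    then show ?thesis
      by (simp add: parseval)
  qed
  have "(\<Sum>S\<in>UNIV. \<bar>fourier_coeff f S\<bar> * \<bar>fourier_coeff g S\<bar>)\<^sup>2 \<le> 1"
    using Cauchy_Schwarz_ineq_sum[of "\<lambda>S. \<bar>fourier_coeff f S\<bar>" "\<lambda>S. \<bar>fourier_coeff g S\<bar>" UNIV]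
    by (simp add: parseval_eq_1 assms)
  then show ?thesis
    by (simp add: abs_mult abs_square_le_1)
qed

section \<open>Correlated pairs\<close>

lemma expectation_prod_Pi_pmf_UNIV:
  fixes h :: "'n::finite \<Rightarrow> 'b::finite \<Rightarrow> real"
  shows "measure_pmf.expectation (Pi_pmf UNIV d p) (\<lambda>z. \<Prod>i\<in>UNIV. h i (z i)) =
    (\<Prod>i\<in>UNIV. measure_pmf.expectation (p i) (h i))"
proof -
  have "measure_pmf.expectation (Pi_pmf UNIV d p) (\<lambda>z. \<Prod>i\<in>UNIV. h i (z i)) =
      (\<Sum>z\<in>UNIV. \<Prod>i\<in>UNIV. h i (z i) * pmf (p i) (z i))"
    by (subst integral_measure_pmf_real[of UNIV]) (auto simp: pmf_Pi prod.distrib)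
  also have "\<dots> = (\<Prod>i\<in>UNIV. \<Sum>b\<in>UNIV. h i b * pmf (p i) b)"
    by (subst prod_sum_PiE) simp_all
  also have "\<dots> = (\<Prod>i\<in>UNIV. measure_pmf.expectation (p i) (h i))"
    by (intro prod.cong refl integral_measure_pmf_real[symmetric]) auto
  finally show ?thesis .
qed

text \<open>Independence gives one factor per coordinate in \<open>S\<close>, each equal to (1 +
  \<rho>) / 2 - (1 - \<rho>) / 2 = \<rho>. The range of \<rho> keeps the Bernoulli parameter in
  [0, 1], where it is not clamped.\<close>

lemma expectation_walsh_noise:
  fixes S :: "'n::finite set"
  assumes "\<rho> \<in> {-1..1}"
  shows "measure_pmf.expectation
      (Pi_pmf UNIV 0 (\<lambda>_. map_pmf of_bool (bernoulli_pmf ((1 - \<rho>) / 2))))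
      (\<lambda>z. walsh S (\<chi> i. z i)) = \<rho> ^ card S"
proof -
  have walsh_eq: "walsh S (\<chi> i. z i) = (\<Prod>i\<in>UNIV. if i \<in> S then bit_sign (z i) else 1)" for z
    by (simp add: walsh_def prod.If_cases)
  have "measure_pmf.expectation (map_pmf of_bool (bernoulli_pmf ((1 - \<rho>) / 2))) bit_sign = \<rho>"
    using assms by (simp add: field_simps)
  then have "measure_pmf.expectation (map_pmf of_bool (bernoulli_pmf ((1 - \<rho>) / 2)))
      (\<lambda>b. if i \<in> S then bit_sign b else 1) = (if i \<in> S then \<rho> else 1)" for i
    by simp
  then show ?thesis
    unfolding walsh_eq
    by (subst expectation_prod_Pi_pmf_UNIV[where h = "\<lambda>i b. if i \<in> S then bit_sign b else 1"])
      (simp add: prod.If_cases)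
qed

lemma expectation_correlated:
  fixes f g :: "bit ^ 'n \<Rightarrow> real"
  assumes "\<rho> \<in> {-1..1}"
  shows "measure_pmf.expectation (correlated_pmf \<rho>) (\<lambda>(x, y). f x * g y) =
    (\<Sum>S\<in>UNIV. fourier_coeff f S * fourier_coeff g S * \<rho> ^ card S)"
proof -
  let ?N = "Pi_pmf UNIV 0 (\<lambda>_ :: 'n. map_pmf of_bool (bernoulli_pmf ((1 - \<rho>) / 2))) :: ('n \<Rightarrow> bit) pmf"
  \<comment> \<open>The noise operator applied to \<open>g\<close>: the mean of g(Y) given X =
    x.\<close>
  define h where "h = (\<lambda>x. \<Sum>S\<in>UNIV. fourier_coeff g S * walsh S x * \<rho> ^ card S)"
  have noise: "measure_pmf.expectation ?N (\<lambda>z. g (x + (\<chi> i. z i))) =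
      h x" for x
    unfolding h_def by (subst fourier_expansion[of g])
      (simp add: walsh_add expectation_walsh_noise[OF assms] mult.assoc
        integrable_measure_pmf_finite)
  have "measure_pmf.expectation (correlated_pmf \<rho>) (\<lambda>(x, y). f x * g y) =
      (\<Sum>x\<in>UNIV. f x * h x) / CARD(bit ^ 'n)"
    unfolding correlated_pmf_def
    by (subst pmf_expectation_bind_pmf_of_set) (simp_all add: noise sum_divide_distrib field_simps)
  also have "\<dots> = (\<Sum>x\<in>UNIV. \<Sum>S\<in>UNIV. f x * walsh S x * (fourier_coeff g S * \<rho> ^ card S)) / CARD(bit ^ 'n)"
    by (simp add: h_def sum_distrib_left mult_ac)
  also have "\<dots> = (\<Sum>S\<in>UNIV. fourier_coeff f S * fourier_coeff g S * \<rho> ^ card S)"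
    by (subst sum.swap, unfold sum_distrib_right[symmetric] sum_mult_walsh)
      (simp add: sum_divide_distrib mult_ac)
  finally show ?thesis .
qed

lemma expectation_correlated_marginals:
  fixes f g :: "bit ^ 'n \<Rightarrow> real"
  assumes "\<rho> \<in> {-1..1}"
  shows "measure_pmf.expectation (correlated_pmf \<rho>) (\<lambda>(x, y). f x) = fourier_empty f"
    and "measure_pmf.expectation (correlated_pmf \<rho>) (\<lambda>(x, y). g y) = fourier_empty g"
proof -
  \<comment> \<open>These rules move the case distinction of \<open>fourier_coeff_const\<close>
    outside the product, so that the sum collapses to its term at \<open>{}\<close>.\<close>
  have eq: "(if P then a else 0) * b * c = (if P then a * b * c else 0)"
    "b * (if P then a else 0) * c = (if P then b * a * c else 0)" for P and a b c :: real
    by auto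
  show "measure_pmf.expectation (correlated_pmf \<rho>) (\<lambda>(x, y). f x) = fourier_empty f"
    using expectation_correlated[OF assms, of f "\<lambda>_. 1"]
    by (simp add: fourier_coeff_const fourier_empty_eq eq)
  show "measure_pmf.expectation (correlated_pmf \<rho>) (\<lambda>(x, y). g y) = fourier_empty g"
    using expectation_correlated[OF assms, of "\<lambda>_. 1" g]
    by (simp add: fourier_coeff_const fourier_empty_eq eq)
qed

section \<open>Fisher information\<close>

text \<open>For signs, the indicator of (f x, g y) = (u, v) is (1 + u * f x) * (1 + v * g y) / 4.
  Unbiasedness kills the mean of the two linear terms and leaves the correlation.\<close>

lemma pmf_joint_pmf:
  fixes f g :: "bit ^ 'n \<Rightarrow> real"
  assumes "\<rho> \<in> {-1..1}"
    and f: "range f \<subseteq> {-1, 1}" and g: "range g \<subseteq> {-1, 1}"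
    and "fourier_empty f = 0" and "fourier_empty g = 0"
    and u: "u \<in> {-1, 1}" and v: "v \<in> {-1, 1}"
  shows "pmf (joint_pmf f g \<rho>) (u, v) =
    (1 + u * v * (\<Sum>S\<in>UNIV. fourier_coeff f S * fourier_coeff g S * \<rho> ^ card S)) / 4"
proof -
  have int: "integrable (measure_pmf (correlated_pmf \<rho>)) h" for h :: "(bit ^ 'n) \<times> (bit ^ 'n) \<Rightarrow> real"
    by (simp add: integrable_measure_pmf_finite)
  have "pmf (joint_pmf f g \<rho>) (u, v) = measure_pmf.expectation (correlated_pmf \<rho>)
      (indicator ((\<lambda>(x, y). (f x, g y)) -` {(u, v)}))"
    by (simp add: joint_pmf_def pmf_map)
  also have "\<dots> = measure_pmf.expectation (correlated_pmf \<rho>)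
      (\<lambda>p. (1 + u * (case p of (x, y) \<Rightarrow> f x) + v * (case p of (x, y) \<Rightarrow> g y)
        + u * v * (case p of (x, y) \<Rightarrow> f x * g y)) / 4)"
  proof (intro Bochner_Integration.integral_cong refl)
    fix p :: "(bit ^ 'n) \<times> (bit ^ 'n)"
    obtain x y where p: "p = (x, y)"
      by (cases p)
    have "f x \<in> {-1, 1}" "g y \<in> {-1, 1}"
      using f g by auto
    with u v show "indicator ((\<lambda>(x, y). (f x, g y)) -` {(u, v)}) p =
      (1 + u * (case p of (x, y) \<Rightarrow> f x) + v * (case p of (x, y) \<Rightarrow> g y)
        + u * v * (case p of (x, y) \<Rightarrow> f x * g y)) / 4"
      by (auto simp: p indicator_def)
  qed
  also have "\<dots> = (1 + u * v * measure_pmf.expectation (correlated_pmf \<rho>) (\<lambda>(x, y). f x * g y)) / 4"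
    using expectation_correlated_marginals[OF assms(1), of f]
      expectation_correlated_marginals[OF assms(1), of g] assms(4,5)
    by (simp add: int)
  finally show ?thesis
    by (simp add: expectation_correlated[OF assms(1)])
qed

text \<open>The squared score turns out to be affine in f x * g y, so its mean needs only the
  correlation \<open>s \<rho>\<close>. The bound on \<open>s \<rho>\<close> makes all four
  probabilities positive, so the logarithms are differentiable.\<close>

lemma fisher_information_eq:
  fixes f g :: "bit ^ 'n \<Rightarrow> real"
  defines "a \<equiv> \<lambda>S. fourier_coeff f S * fourier_coeff g S"
  defines "s \<equiv> \<lambda>r. \<Sum>S\<in>UNIV. a S * r ^ card S"
  assumes \<rho>: "\<rho> \<in> {-1<..<1}"
    and f: "range f \<subseteq> {-1, 1}" and g: "range g \<subseteq> {-1, 1}"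
    and unbiased: "fourier_empty f = 0" "fourier_empty g = 0"
    and s: "\<bar>s \<rho>\<bar> < 1" and s': "(s has_real_derivative s') (at \<rho>)"
  shows "fisher_information f g \<rho> = s'\<^sup>2 / (1 - (s \<rho>)\<^sup>2)"
proof -
  have sq: "(s \<rho>)\<^sup>2 < 1"
    using s by (simp add: abs_square_less_1)
  have score: "(deriv (\<lambda>r. ln (pmf (joint_pmf f g r) (f x, g y))) \<rho>)\<^sup>2 =
      s'\<^sup>2 / (1 - (s \<rho>)\<^sup>2)\<^sup>2 * (1 + (s \<rho>)\<^sup>2 - 2 * s \<rho> * (f x * g y))" for x y
  proof -
    define c where "c = f x * g y"
    have uv: "f x \<in> {-1, 1}" "g y \<in> {-1, 1}"
      using f g by auto
    then have c: "c = 1 \<or> c = -1"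
      by (auto simp: c_def)
    then have pos: "1 + c * s \<rho> > 0" "1 - c * s \<rho> > 0"
      using s by auto
    have "((\<lambda>r. ln ((1 + c * s r) / 4)) has_real_derivative c * s' / (1 + c * s \<rho>)) (at \<rho>)"
      using pos by (auto intro!: derivative_eq_intros s' simp: field_simps)
    then have "((\<lambda>r. ln (pmf (joint_pmf f g r) (f x, g y))) has_real_derivative
        c * s' / (1 + c * s \<rho>)) (at \<rho>)"
    \<comment> \<open>The closed form of the probabilities holds only where the Bernoulli parameter
      is not clamped, hence the open interval around \<rho>.\<close>
    proof (rule has_field_derivative_transform_within_open)
      show "ln ((1 + c * s r) / 4) = ln (pmf (joint_pmf f g r) (f x, g y))"
        if "r \<in> {-1<..<1}" for r
        using that by (subst pmf_joint_pmf[OF _ f g unbiased uv]) (auto simp: c_def s_def a_def)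
    qed (use \<rho> in auto)
    then have "(deriv (\<lambda>r. ln (pmf (joint_pmf f g r) (f x, g y))) \<rho>)\<^sup>2 =
        (c * s' / (1 + c * s \<rho>))\<^sup>2"
      by (simp add: DERIV_imp_deriv)
    \<comment> \<open>Since c * c = 1, multiplying by the conjugate yields a denominator free of
      \<open>c\<close>, and squaring the numerator leaves \<open>c\<close> only to first
      order.\<close>
    also have "c * s' / (1 + c * s \<rho>) = c * s' * (1 - c * s \<rho>) / ((1 + c * s \<rho>) * (1 - c * s \<rho>))"
      using pos by simp
    also have "(1 + c * s \<rho>) * (1 - c * s \<rho>) = 1 - (s \<rho>)\<^sup>2"
      using c by (auto simp: algebra_simps power2_eq_square)
    also have "(c * s' * (1 - c * s \<rho>) / (1 - (s \<rho>)\<^sup>2))\<^sup>2 =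
        s'\<^sup>2 / (1 - (s \<rho>)\<^sup>2)\<^sup>2 * (1 + (s \<rho>)\<^sup>2 - 2 * s \<rho> * c)"
      using c by (auto simp: power_divide power_mult_distrib power2_diff power2_sum)
    finally show ?thesis
      by (simp add: c_def)
  qed
  have int: "integrable (measure_pmf (correlated_pmf \<rho>)) h" for h :: "(bit ^ 'n) \<times> (bit ^ 'n) \<Rightarrow> real"
    by (simp add: integrable_measure_pmf_finite)
  have "fisher_information f g \<rho> = measure_pmf.expectation (correlated_pmf \<rho>)
      (\<lambda>p. s'\<^sup>2 / (1 - (s \<rho>)\<^sup>2)\<^sup>2 * (1 + (s \<rho>)\<^sup>2 - 2 * s \<rho> * (case p of (x, y) \<Rightarrow> f x * g y)))"
    unfolding fisher_information_def score by (simp add: case_prod_unfold)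
  also have "\<dots> = s'\<^sup>2 / (1 - (s \<rho>)\<^sup>2)\<^sup>2 * (1 + (s \<rho>)\<^sup>2 - 2 * s \<rho> * s \<rho>)"
    using \<rho> expectation_correlated[of \<rho> f g] by (simp add: int s_def a_def)
  also have "\<dots> = s'\<^sup>2 / (1 - (s \<rho>)\<^sup>2)"
    using sq by (simp add: power2_eq_square)
  finally show ?thesis .
qed

text \<open>Cauchy-Schwarz with weights \<open>\<bar>a i\<bar>\<close> is used twice: for
  \<open>c\<close> to bound the left side, and for \<open>x\<close> to bring back the square of the
  weighted sum on the right.\<close>

lemma weighted_sum_sq_le:
  fixes a x c :: "'a \<Rightarrow> real"
  assumes M: "0 \<le> M" and c: "\<And>i. i \<in> I \<Longrightarrow> (c i)\<^sup>2 \<le> M * (1 - (x i)\<^sup>2)"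
    and a: "(\<Sum>i\<in>I. \<bar>a i\<bar>) \<le> 1"
  shows "(\<Sum>i\<in>I. a i * c i)\<^sup>2 \<le> M * (1 - (\<Sum>i\<in>I. a i * x i)\<^sup>2)"
proof -
  define W where "W = (\<Sum>i\<in>I. \<bar>a i\<bar>)"
  have W: "0 \<le> W" "W \<le> 1"
    using a by (auto simp: W_def sum_nonneg)
  have cs: "(\<Sum>i\<in>I. a i * y i)\<^sup>2 \<le> W * (\<Sum>i\<in>I. \<bar>a i\<bar> * (y i)\<^sup>2)" for y
  proof -
    \<comment> \<open>One root of the weight goes to each Cauchy-Schwarz factor; the sign stays with
      \<open>y i\<close>.\<close>
    have "a i = sgn (a i) * sqrt \<bar>a i\<bar> * sqrt \<bar>a i\<bar>" for i
      by (simp add: mult.assoc sgn_mult_abs)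
    then have "(\<Sum>i\<in>I. a i * y i) = (\<Sum>i\<in>I. sqrt \<bar>a i\<bar> * (sgn (a i) * sqrt \<bar>a i\<bar> * y i))"
      by (intro sum.cong refl) (metis mult.assoc mult.commute)
    also have "\<dots>\<^sup>2 \<le> (\<Sum>i\<in>I. (sqrt \<bar>a i\<bar>)\<^sup>2) * (\<Sum>i\<in>I. (sgn (a i) * sqrt \<bar>a i\<bar> * y i)\<^sup>2)"
      by (rule Cauchy_Schwarz_ineq_sum)
    also have "\<dots> = W * (\<Sum>i\<in>I. \<bar>a i\<bar> * (y i)\<^sup>2)"
    proof -
      have "(sgn (a i) * sqrt \<bar>a i\<bar> * y i)\<^sup>2 = \<bar>a i\<bar> * (y i)\<^sup>2" for i
        by (cases "a i = 0") (auto simp: power_mult_distrib sgn_if)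
      then show ?thesis
        by (simp add: W_def)
    qed
    finally show ?thesis .
  qed
  have "(\<Sum>i\<in>I. a i * c i)\<^sup>2 \<le> W * (\<Sum>i\<in>I. \<bar>a i\<bar> * (c i)\<^sup>2)"
    by (rule cs)
  also have "\<dots> \<le> W * (\<Sum>i\<in>I. \<bar>a i\<bar> * (M * (1 - (x i)\<^sup>2)))"
    by (intro mult_left_mono sum_mono c W) auto
  also have "(\<Sum>i\<in>I. \<bar>a i\<bar> * (M * (1 - (x i)\<^sup>2))) = M * (W - (\<Sum>i\<in>I. \<bar>a i\<bar> * (x i)\<^sup>2))"
    by (simp add: W_def sum_distrib_left sum_subtractf algebra_simps)
  also have "W * (M * (W - (\<Sum>i\<in>I. \<bar>a i\<bar> * (x i)\<^sup>2))) =
      M * (W * W - W * (\<Sum>i\<in>I. \<bar>a i\<bar> * (x i)\<^sup>2))"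
    by (simp add: algebra_simps)
  \<comment> \<open>The total weight satisfies W * W \<le> 1, and \<open>cs\<close> for
    \<open>x\<close> bounds the subtracted term from below.\<close>
  also have "\<dots> \<le> M * (1 - (\<Sum>i\<in>I. a i * x i)\<^sup>2)"
    using M W cs[of x] by (intro mult_left_mono diff_mono) (auto intro: mult_le_one)
  finally show ?thesis .
qed

theorem theorem4:
  fixes f g :: "bit ^ 'n \<Rightarrow> real" and \<rho> :: real
  assumes "\<rho> \<in> {-1<..<1}"
    and "range f \<subseteq> {-1, 1}" and "range g \<subseteq> {-1, 1}"
    and "fourier_empty f = 0" and "fourier_empty g = 0"
  shows "fisher_information f g \<rho> \<le>
    (MAX k\<in>{1..CARD('n)}. (real k)\<^sup>2 * \<rho> ^ (2 * (k - 1)) / (1 - \<rho> ^ (2 * k)))"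
proof -
  define a where "a = (\<lambda>S. fourier_coeff f S * fourier_coeff g S)"
  define s where "s = (\<lambda>r. \<Sum>S\<in>UNIV. a S * r ^ card S)"
  \<comment> \<open>The truncated exponent \<open>card S - 1\<close> is the true one, as
    \<open>S\<close> is nonempty here.\<close>
  define s' where "s' = (\<Sum>S\<in>UNIV - {{}}. a S * (real (card S) * \<rho> ^ (card S - 1)))"
  define M where "M = (MAX k\<in>{1..CARD('n)}. (real k)\<^sup>2 * \<rho> ^ (2 * (k - 1)) / (1 - \<rho> ^ (2 * k)))"
  have a_empty: "a {} = 0"
    using assms(4) by (simp add: a_def fourier_empty_eq)
  have s_eq: "s = (\<lambda>r. \<Sum>S\<in>UNIV - {{}}. a S * r ^ card S)"
    unfolding s_def by (intro ext sum.mono_neutral_right) (auto simp: a_empty)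
  have sum_a: "(\<Sum>S\<in>UNIV - {{}}. \<bar>a S\<bar>) \<le> 1"
    using sum_mono2[of UNIV "UNIV - {{}}" "\<lambda>S. \<bar>a S\<bar>"] sum_abs_fourier_coeff_le[OF assms(2,3)]
    by (simp add: a_def)
  have card: "card S \<in> {1..CARD('n)}" if "S \<in> UNIV - {{}}" for S :: "'n set"
    using that by (auto simp: Suc_le_eq card_gt_0_iff intro: card_mono)
  have \<rho>_less: "\<bar>\<rho>\<bar> < 1"
    using assms(1) by auto
  have deriv: "(s has_real_derivative s') (at \<rho>)"
    unfolding s_eq s'_def by (auto intro!: derivative_eq_intros sum.cong)
  \<comment> \<open>With the constant term gone, every monomial is at most
    \<open>\<bar>\<rho>\<bar>\<close> in absolute value.\<close>
  have "\<bar>s \<rho>\<bar> \<le> (\<Sum>S\<in>UNIV - {{}}. \<bar>a S\<bar> * \<bar>\<rho>\<bar>)"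
    unfolding s_eq
  proof (intro order_trans[OF sum_abs] sum_mono)
    fix S :: "'n set" assume "S \<in> UNIV - {{}}"
    then have "\<bar>\<rho>\<bar> ^ card S \<le> \<bar>\<rho>\<bar> ^ 1"
      using card[of S] \<rho>_less by (intro power_decreasing) auto
    then show "\<bar>a S * \<rho> ^ card S\<bar> \<le> \<bar>a S\<bar> * \<bar>\<rho>\<bar>"
      by (simp add: abs_mult power_abs mult_left_mono)
  qed
  also have "\<dots> \<le> 1 * \<bar>\<rho>\<bar>"
    unfolding sum_distrib_right[symmetric] by (intro mult_right_mono sum_a) auto
  finally have s_less: "\<bar>s \<rho>\<bar> < 1"
    using \<rho>_less by simp
  \<comment> \<open>The desired bound for the single monomial \<rho> ^ k, cleared of its denominator
    to fit \<open>weighted_sum_sq_le\<close>.\<close>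
  have term_le: "(real k * \<rho> ^ (k - 1))\<^sup>2 \<le> M * (1 - (\<rho> ^ k)\<^sup>2)" if k: "k \<in> {1..CARD('n)}" for k
  proof -
    have "\<bar>\<rho> ^ k\<bar> < 1"
      using k \<rho>_less by (simp add: power_abs power_less_one_iff)
    then have pos: "1 - (\<rho> ^ k)\<^sup>2 > 0"
      by (simp add: abs_square_less_1)
    have "(real k)\<^sup>2 * \<rho> ^ (2 * (k - 1)) / (1 - \<rho> ^ (2 * k)) \<le> M"
      unfolding M_def using k by (intro Max_ge) auto
    moreover have "(real k)\<^sup>2 * \<rho> ^ (2 * (k - 1)) = (real k * \<rho> ^ (k - 1))\<^sup>2"
      by (simp add: power_mult_distrib power_mult[symmetric] mult.commute)
    moreover have "\<rho> ^ (2 * k) = (\<rho> ^ k)\<^sup>2"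
      by (simp add: power_mult[symmetric] mult.commute)
    ultimately show ?thesis
      using pos by (simp add: pos_divide_le_eq)
  qed
  \<comment> \<open>The index k = 1 is always in the range of the maximum, and its bound forces the
    sign of \<open>M\<close>.\<close>
  have M: "0 \<le> M"
  proof -
    have "0 \<le> M * (1 - \<rho>\<^sup>2)"
      using term_le[of 1] by (simp add: Suc_le_eq)
    moreover have "1 - \<rho>\<^sup>2 > 0"
      using \<rho>_less by (simp add: abs_square_less_1)
    ultimately show ?thesis
      by (simp add: zero_le_mult_iff)
  qed
  have "s'\<^sup>2 \<le> M * (1 - (s \<rho>)\<^sup>2)"
    unfolding s_eq s'_def by (rule weighted_sum_sq_le[OF M term_le[OF card] sum_a])
  moreover have "1 - (s \<rho>)\<^sup>2 > 0"
    using s_less by (simp add: abs_square_less_1)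
  ultimately have "s'\<^sup>2 / (1 - (s \<rho>)\<^sup>2) \<le> M"
    by (simp add: pos_divide_le_eq)
  moreover have "fisher_information f g \<rho> = s'\<^sup>2 / (1 - (s \<rho>)\<^sup>2)"
    using fisher_information_eq[OF assms, of s'] s_less deriv unfolding s_def a_def by simp
  ultimately show ?thesis
    by (simp add: M_def)
qed

end
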